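(* Let $n\geq 2$, let $\{e_1,\dots,e_n\}$ be an orthonormal basis of $\mathbb{R}^n$, and let $K=\{-\alpha e_1,\alpha e_1\}$ with $\alpha>0$. For $x\in\mathbb{R}$ and $y=y_2e_2+\cdots+y_ne_n$ write $(x,y)$ for the point $xe_1+y\in\mathbb{R}^n$. Then for every $\lambda>0$, $$M_\lambda((x,y);K)=\begin{cases}(1+\lambda)^2\left(|x|-\dfrac{\alpha}{1+\lambda}\right)^2, & |x|\leq\dfrac{\alpha}{1+\lambda},\\[2ex] 0, & |x|\geq\dfrac{\alpha}{1+\lambda}.\end{cases}$$
   Context: $|\cdot|$ is the Euclidean norm and $\mathrm{dist}(z;E)=\inf\{|z-w|: w\in E\}$ for non-empty $E\subset\mathbb{R}^n$. For a continuous function $f:\mathbb{R}^n\to\mathbb{R}$ bounded below, $\mathrm{co}[f]$ denotes the convex envelope, i.e. the largest convex function not greater than $f$. For $\lambda>0$ the lower compensated convex transform is $C^l_\lambda(f)(z)=\mathrm{co}[f+\lambda|\cdot|^2](z)-\lambda|z|^2$. The quadratic multiscale medial axis map of a non-empty closed set $K$ with scale $\lambda>0$ is $M_\lambda(z;K)=(1+\lambda)\big(\mathrm{dist}^2(z;K)-C^l_\lambda(\mathrm{dist}^2(\cdot;K))(z)\big)$, $z\in\mathbb{R}^n$. *)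

theory Defs
  imports "HOL-Analysis.Analysis"
begin

(* The order on functions is pointwise.  For f bounded below the greatest element
   exists, see convex_envelope_greatest; for other f the value may be unspecified. *)
definition convex_envelope :: "('a::real_vector \<Rightarrow> real) \<Rightarrow> 'a \<Rightarrow> real" where
  "convex_envelope f = (GREATEST g. convex_on UNIV g \<and> g \<le> f)"

definition lower_convex_transform ::
    "real \<Rightarrow> ('a::real_normed_vector \<Rightarrow> real) \<Rightarrow> 'a \<Rightarrow> real" where
  "lower_convex_transform lam f z =
     convex_envelope (\<lambda>w. f w + lam * (norm w)\<^sup>2) z - lam * (norm z)\<^sup>2"

definition medial_axis_map ::
    "real \<Rightarrow> 'a::real_normed_vector set \<Rightarrow> 'a \<Rightarrow> real" where
  "medial_axis_map lam K z =
     (1 + lam) * ((infdist z K)\<^sup>2 - lower_convex_transform lam (\<lambda>w. (infdist w K)\<^sup>2) z)"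

definition orthonormal_basis :: "(nat \<Rightarrow> real ^ 'n) \<Rightarrow> bool" where
  "orthonormal_basis e \<longleftrightarrow>
     (\<forall>i\<in>{1..CARD('n)}. \<forall>j\<in>{1..CARD('n)}. e i \<bullet> e j = (if i = j then 1 else 0)) \<and>
     span (e ` {1..CARD('n)}) = UNIV"

lemma convex_envelope_greatest:
  fixes f :: "'a::real_vector \<Rightarrow> real"
  assumes "bdd_below (range f)"
  shows "convex_on UNIV (convex_envelope f)"
    and "convex_envelope f \<le> f"
    and "\<And>h. convex_on UNIV h \<Longrightarrow> h \<le> f \<Longrightarrow> h \<le> convex_envelope f"
proof -
  define A where "A = {g. convex_on UNIV g \<and> g \<le> f}"
  define s where "s = (\<lambda>z. SUP g\<in>A. g z)"
  obtain c where c: "\<And>w. c \<le> f w"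
    using assms unfolding bdd_below_def by auto
  have "(\<lambda>_. c) \<in> A"
    using c by (auto simp: A_def le_fun_def convex_on_const)
  then have ne: "A \<noteq> {}" by blast
  have bdd: "bdd_above ((\<lambda>g. g z) ` A)" for z
    by (rule bdd_aboveI[of _ "f z"]) (auto simp: A_def le_fun_def)
  have upper: "g z \<le> s z" if "g \<in> A" for g z
    unfolding s_def using that bdd by (rule cSUP_upper)
  have "s \<le> f"
    unfolding s_def le_fun_def using ne
    by (auto intro!: cSUP_least simp: A_def le_fun_def)
  moreover have "convex_on UNIV s"
  proof (rule convex_onI)
    fix t :: real and x y :: 'a
    assume t: "0 < t" "t < 1"
    show "s ((1 - t) *\<^sub>R x + t *\<^sub>R y) \<le> (1 - t) * s x + t * s y"
      unfolding s_def
    proof (rule cSUP_least[OF ne])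
      fix g assume g: "g \<in> A"
      then have "g ((1 - t) *\<^sub>R x + t *\<^sub>R y) \<le> (1 - t) * g x + t * g y"
        using t by (auto simp: A_def intro!: convex_onD[of UNIV g])
      also have "\<dots> \<le> (1 - t) * s x + t * s y"
        using t upper[OF g] by (intro add_mono mult_left_mono) auto
      finally show "g ((1 - t) *\<^sub>R x + t *\<^sub>R y)
          \<le> (1 - t) * (SUP g\<in>A. g x) + t * (SUP g\<in>A. g y)"
        unfolding s_def .
    qed
  qed simp
  moreover have "h \<le> s" if "convex_on UNIV h" "h \<le> f" for h
    using upper[of h] that by (auto simp: A_def le_fun_def)
  moreover from calculation have "convex_envelope f = s"
    unfolding convex_envelope_def by (intro Greatest_equality) auto
  ultimately show "convex_on UNIV (convex_envelope f)"
    and "convex_envelope f \<le> f"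
    and "\<And>h. convex_on UNIV h \<Longrightarrow> h \<le> f \<Longrightarrow> h \<le> convex_envelope f"
    by simp_all
qed

end

theory Submission
  imports Defs
begin

text \<open>
  Put \<open>x = z \<bullet> u\<close>, \<open>u = e 1\<close> and \<open>s = \<alpha> / (1 + \<lambda>)\<close>. Completing the square,
  \<open>dist\<^sup>2 + \<lambda> |z|\<^sup>2 = (1 + \<lambda>) (|z - x u|\<^sup>2 + (|x| - s)\<^sup>2) + const\<close>, so only the
  one-dimensional double well \<open>(|x| - s)\<^sup>2\<close> is not convex. Its envelope \<open>(max 0 (|x| - s))\<^sup>2\<close>
  is optimal because each point with \<open>|x| \<le> s\<close> is a convex combination, along \<open>u\<close>, of points
  with \<open>x = \<plusminus>s\<close>, where both wells vanish.
\<close>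

lemma convex_envelope_eqI:
  assumes "convex_on UNIV g" "g \<le> f"
    and "\<And>h. convex_on UNIV h \<Longrightarrow> h \<le> f \<Longrightarrow> h \<le> g"
  shows "convex_envelope f = g"
  unfolding convex_envelope_def using assms by (intro Greatest_equality) auto

text \<open>Squaring is convex on the reals and increasing on nonnegative ones, so it may be
  composed with a nonnegative convex function.\<close>

lemma convex_on_square_nonneg:
  fixes f :: "'a::real_vector \<Rightarrow> real"
  assumes "convex_on A f" and nonneg: "\<And>x. x \<in> A \<Longrightarrow> 0 \<le> f x"
  shows "convex_on A (\<lambda>x. (f x)\<^sup>2)"
proof (rule convex_onI)
  show "convex A"
    using assms(1) by (rule convex_on_imp_convex)
next
  fix t :: real and x y assume t: "0 < t" "t < 1" and xy: "x \<in> A" "y \<in> A"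
  have "(1 - t) *\<^sub>R x + t *\<^sub>R y \<in> A"
    using convex_on_imp_convex[OF assms(1)] t xy by (simp add: convex_alt)
  then have "(f ((1 - t) *\<^sub>R x + t *\<^sub>R y))\<^sup>2 \<le> ((1 - t) * f x + t * f y)\<^sup>2"
    using t xy by (intro power_mono convex_onD[OF assms(1)] nonneg) auto
  also have "\<dots> \<le> (1 - t) * (f x)\<^sup>2 + t * (f y)\<^sup>2"
    using convex_onD[OF convex_power2, of t "f x" "f y"] t by simp
  finally show "(f ((1 - t) *\<^sub>R x + t *\<^sub>R y))\<^sup>2 \<le> (1 - t) * (f x)\<^sup>2 + t * (f y)\<^sup>2" .
qed

lemma convex_on_norm_linear:
  assumes "linear L"
  shows "convex_on UNIV (\<lambda>x. norm (L x))"
proof (rule convex_onI)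
  fix t :: real and x y assume t: "0 < t" "t < 1"
  have "norm (L ((1 - t) *\<^sub>R x + t *\<^sub>R y)) = norm ((1 - t) *\<^sub>R L x + t *\<^sub>R L y)"
    by (simp add: linear_add[OF assms] linear_scale[OF assms])
  also have "\<dots> \<le> (1 - t) * norm (L x) + t * norm (L y)"
    using t by (intro order_trans[OF norm_triangle_ineq]) simp
  finally show "norm (L ((1 - t) *\<^sub>R x + t *\<^sub>R y)) \<le> (1 - t) * norm (L x) + t * norm (L y)" .
qed simp

lemma convex_on_max:
  fixes f g :: "'a::real_vector \<Rightarrow> real"
  assumes "convex_on A f" "convex_on A g"
  shows "convex_on A (\<lambda>x. max (f x) (g x))"
proof (rule convex_onI)
  show "convex A"
    using assms(1) by (rule convex_on_imp_convex)
next
  fix t :: real and x y assume t: "0 < t" "t < 1" and xy: "x \<in> A" "y \<in> A"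
  have "(1 - t) * f x + t * f y \<le> (1 - t) * max (f x) (g x) + t * max (f y) (g y)"
    and "(1 - t) * g x + t * g y \<le> (1 - t) * max (f x) (g x) + t * max (f y) (g y)"
    using t by (auto intro!: add_mono mult_left_mono)
  then show "max (f ((1 - t) *\<^sub>R x + t *\<^sub>R y)) (g ((1 - t) *\<^sub>R x + t *\<^sub>R y))
      \<le> (1 - t) * max (f x) (g x) + t * max (f y) (g y)"
    using convex_onD[OF assms(1), of t x y] convex_onD[OF assms(2), of t x y] t xy by simp
qed

lemma infdist_doubleton: "infdist x {a, b} = min (dist x a) (dist x b)"
  by (simp add: infdist_def cInf_eq_Min)

text \<open>The squared distances to the two points differ only in the sign of the cross term; since
  \<open>\<alpha> > 0\<close>, the smaller one carries the absolute value.\<close>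

lemma infdist_antipodal_square:
  fixes u w :: "'a::real_inner"
  assumes "norm u = 1" and "\<alpha> > 0"
  shows "(infdist w {- (\<alpha> *\<^sub>R u), \<alpha> *\<^sub>R u})\<^sup>2 = (norm w)\<^sup>2 - 2 * \<alpha> * \<bar>w \<bullet> u\<bar> + \<alpha>\<^sup>2"
proof -
  have uu: "u \<bullet> u = 1"
    using assms(1) by (simp add: dot_square_norm)
  have d: "(dist w (c *\<^sub>R u))\<^sup>2 = (norm w)\<^sup>2 - 2 * c * (w \<bullet> u) + c\<^sup>2" for c
    unfolding dist_norm power2_norm_eq_inner
    by (simp add: inner_diff_left inner_diff_right inner_commute[of u w] uu power2_eq_square
        algebra_simps)
  have "(min a b)\<^sup>2 = min (a\<^sup>2) (b\<^sup>2)" if "0 \<le> a" "0 \<le> b" for a b :: real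
    using that power_mono[of a b 2] power_mono[of b a 2] by (auto simp: min_def)
  \<comment> \<open>The first point is taken with coefficient \<open>- \<alpha>\<close>, so that
    \<open>d\<close> expands both distances.\<close>
  then have "(infdist w {- (\<alpha> *\<^sub>R u), \<alpha> *\<^sub>R u})\<^sup>2
      = min ((dist w ((- \<alpha>) *\<^sub>R u))\<^sup>2) ((dist w (\<alpha> *\<^sub>R u))\<^sup>2)"
    by (simp add: infdist_doubleton)
  also have "\<dots> = (norm w)\<^sup>2 - 2 * \<alpha> * \<bar>w \<bullet> u\<bar> + \<alpha>\<^sup>2"
    unfolding d using assms(2) by (auto simp: min_def abs_if mult_le_0_iff)
  finally show ?thesis .
qed

lemma convex_envelope_double_well:
  fixes u :: "'a::real_inner"
  assumes u: "norm u = 1" and c: "0 \<le> c" and s: "0 < s"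
  shows "convex_envelope (\<lambda>w. c * ((norm (w - (w \<bullet> u) *\<^sub>R u))\<^sup>2 + (\<bar>w \<bullet> u\<bar> - s)\<^sup>2) + d)
    = (\<lambda>w. c * ((norm (w - (w \<bullet> u) *\<^sub>R u))\<^sup>2 + (max 0 (\<bar>w \<bullet> u\<bar> - s))\<^sup>2) + d)"
    (is "convex_envelope ?F = ?g")
proof (rule convex_envelope_eqI)
  have "linear (\<lambda>w. w - (w \<bullet> u) *\<^sub>R u)"
    by (rule linearI) (simp_all add: inner_add_left algebra_simps)
  then have "convex_on UNIV (\<lambda>w. (norm (w - (w \<bullet> u) *\<^sub>R u))\<^sup>2)"
    by (intro convex_on_square_nonneg convex_on_norm_linear) auto
  moreover have "linear (\<lambda>w. w \<bullet> u)"
    by (rule linearI) (simp_all add: inner_add_left)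
  \<comment> \<open>On the reals \<open>norm\<close> is the absolute value; this spelling fits
    \<open>convex_on_norm_linear\<close>.\<close>
  then have "convex_on UNIV (\<lambda>w. norm (w \<bullet> u) + (- s))"
    by (intro convex_on_add convex_on_norm_linear) (auto simp: convex_on_const)
  then have "convex_on UNIV (\<lambda>w. (max 0 (\<bar>w \<bullet> u\<bar> - s))\<^sup>2)"
    by (intro convex_on_square_nonneg convex_on_max) (auto simp: convex_on_const)
  ultimately show "convex_on UNIV ?g"
    using c by (intro convex_on_add convex_on_cmul) (auto simp: convex_on_const)
next
  have "(max 0 r)\<^sup>2 \<le> r\<^sup>2" for r :: real
    by (auto simp: max_def)
  then show "?g \<le> ?F"
    using c by (auto simp: le_fun_def intro!: mult_left_mono)
next
  fix h assume h: "convex_on UNIV h" "h \<le> ?F"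
  have uu: "u \<bullet> u = 1"
    using u by (simp add: dot_square_norm)
  show "h \<le> ?g"
  proof (rule le_funI)
    fix w
    define x where "x = w \<bullet> u"
    show "h w \<le> ?g w"
    proof (cases "\<bar>x\<bar> \<le> s")
      case False
      then show ?thesis
        using h(2) by (simp add: le_fun_def x_def max_def)
    next
      case True
      \<comment> \<open>\<open>p r\<close> slides \<open>w\<close> along \<open>u\<close> until its
        coordinate is \<open>r\<close>; the weight \<open>t\<close> solves
        \<open>(1 - t) * (- s) + t * s = x\<close>.\<close>
      define p where "p r = w + (r - x) *\<^sub>R u" for r
      define t where "t = (x + s) / (2 * s)"
      have t: "0 \<le> t" "t \<le> 1"
        using True s by (auto simp: t_def field_simps)
      have pu: "p r \<bullet> u = r" for r
        by (simp add: p_def inner_add_left uu x_def)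
      \<comment> \<open>Sliding preserves the component orthogonal to \<open>u\<close>. At
        \<open>\<bar>r\<bar> = s\<close> the well vanishes, and so does the \<open>max\<close> term
        at \<open>w\<close>, hence \<open>?F (p r) = ?g w\<close>.\<close>
      have bound: "h (p r) \<le> ?g w" if "\<bar>r\<bar> = s" for r
      proof -
        have "p r - r *\<^sub>R u = w - x *\<^sub>R u"
          by (simp add: p_def algebra_simps)
        moreover have "h (p r) \<le> ?F (p r)"
          using h(2) by (simp add: le_fun_def)
        ultimately show ?thesis
          using that True by (simp add: pu x_def)
      qed
      \<comment> \<open>The weighted displacements from \<open>w\<close> cancel, so the two slid
        points average to \<open>w\<close>.\<close>
      have "(1 - t) * (- s - x) + t * (s - x) = 0"
        using s by (simp add: t_def field_simps)
      moreover have "(1 - t) *\<^sub>R p (- s) + t *\<^sub>R p s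
          = w + ((1 - t) * (- s - x) + t * (s - x)) *\<^sub>R u"
        by (simp add: p_def algebra_simps flip: scaleR_add_left)
      ultimately have "w = (1 - t) *\<^sub>R p (- s) + t *\<^sub>R p s"
        by simp
      then have "h w \<le> (1 - t) * h (p (- s)) + t * h (p s)"
        using convex_onD[OF h(1), of t "p (- s)" "p s"] t by simp
      also have "\<dots> \<le> ?g w"
        using t s by (intro convex_bound_le bound) auto
      finally show ?thesis .
    qed
  qed
qed

text \<open>The map measures the gap between the double well and its envelope; \<open>min 0\<close>
  merges the two cases, being zero once the coordinate reaches the well.\<close>

lemma medial_axis_map_antipodal:
  fixes u z :: "'a::real_inner"
  assumes u: "norm u = 1" and \<alpha>: "\<alpha> > 0" and lam: "lam > 0"
  shows "medial_axis_map lam {- (\<alpha> *\<^sub>R u), \<alpha> *\<^sub>R u} z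
    = (1 + lam)\<^sup>2 * (min 0 (\<bar>z \<bullet> u\<bar> - \<alpha> / (1 + lam)))\<^sup>2"
proof -
  define s where "s = \<alpha> / (1 + lam)"
  have s: "0 < s" "\<alpha> = (1 + lam) * s" and c: "0 \<le> 1 + lam"
    using \<alpha> lam by (auto simp: s_def)
  have uu: "u \<bullet> u = 1"
    using u by (simp add: dot_square_norm)
  \<comment> \<open>The constant left by completing the square in
    \<open>\<bar>w \<bullet> u\<bar>\<close>; the cross terms match because
    \<open>\<alpha> = (1 + lam) * s\<close>.\<close>
  define d where "d = \<alpha>\<^sup>2 - (1 + lam) * s\<^sup>2"
  have pyth: "(norm (w - (w \<bullet> u) *\<^sub>R u))\<^sup>2 = (norm w)\<^sup>2 - (w \<bullet> u)\<^sup>2" for w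
    unfolding power2_norm_eq_inner
    by (simp add: inner_diff_left inner_diff_right inner_commute[of u w] uu power2_eq_square)
  have F: "(infdist w {- (\<alpha> *\<^sub>R u), \<alpha> *\<^sub>R u})\<^sup>2 + lam * (norm w)\<^sup>2
      = (1 + lam) * ((norm (w - (w \<bullet> u) *\<^sub>R u))\<^sup>2 + (\<bar>w \<bullet> u\<bar> - s)\<^sup>2) + d" for w
    unfolding infdist_antipodal_square[OF u \<alpha>] pyth d_def power2_diff
    by (simp add: s(2) algebra_simps)
  \<comment> \<open>By \<open>F\<close> at \<open>z\<close>, the terms
    \<open>lam * (norm z)\<^sup>2\<close>, the orthogonal part and \<open>d\<close> all
    cancel.\<close>
  have "(infdist z {- (\<alpha> *\<^sub>R u), \<alpha> *\<^sub>R u})\<^sup>2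
      - lower_convex_transform lam (\<lambda>w. (infdist w {- (\<alpha> *\<^sub>R u), \<alpha> *\<^sub>R u})\<^sup>2) z
    = (1 + lam) * ((\<bar>z \<bullet> u\<bar> - s)\<^sup>2 - (max 0 (\<bar>z \<bullet> u\<bar> - s))\<^sup>2)"
    unfolding lower_convex_transform_def F convex_envelope_double_well[OF u c s(1)]
    using F[of z] by (simp add: algebra_simps)
  \<comment> \<open>For real \<open>r\<close>, one of \<open>max 0 r\<close> and
    \<open>min 0 r\<close> is zero and the other is \<open>r\<close>.\<close>
  also have "(\<bar>z \<bullet> u\<bar> - s)\<^sup>2 - (max 0 (\<bar>z \<bullet> u\<bar> - s))\<^sup>2 = (min 0 (\<bar>z \<bullet> u\<bar> - s))\<^sup>2"
    by (auto simp: max_def min_def)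
  finally show ?thesis
    unfolding medial_axis_map_def s_def[symmetric] by (simp add: power2_eq_square)
qed

theorem proposition4p1:
  fixes e :: "nat \<Rightarrow> real ^ 'n" and \<alpha> lam x :: real and y :: "nat \<Rightarrow> real"
    and K :: "(real ^ 'n) set" and z :: "real ^ 'n"
  assumes "CARD('n) \<ge> 2"
    and "orthonormal_basis e"
    and "\<alpha> > 0"
    and "lam > 0"
    and "K = {- (\<alpha> *\<^sub>R e 1), \<alpha> *\<^sub>R e 1}"
    and "z = x *\<^sub>R e 1 + (\<Sum>i=2..CARD('n). y i *\<^sub>R e i)"
  shows "(\<bar>x\<bar> \<le> \<alpha> / (1 + lam) \<longrightarrow>
            medial_axis_map lam K z = (1 + lam)\<^sup>2 * (\<bar>x\<bar> - \<alpha> / (1 + lam))\<^sup>2) \<and>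
         (\<bar>x\<bar> \<ge> \<alpha> / (1 + lam) \<longrightarrow> medial_axis_map lam K z = 0)"
proof -
  have on: "e i \<bullet> e 1 = (if i = 1 then 1 else 0)" if "i \<in> {1..CARD('n)}" for i
    using assms(1,2) that by (auto simp: orthonormal_basis_def)
  have ee: "e 1 \<bullet> e 1 = 1"
    using on[of 1] assms(1) by simp
  then have "norm (e 1) = 1"
    by (simp add: norm_eq_sqrt_inner)
  moreover have "z \<bullet> e 1 = x"
    \<comment> \<open>Each \<open>e i\<close> with \<open>i \<ge> 2\<close> is orthogonal to
      \<open>e 1\<close>, so only the first term survives. Keeping \<open>1\<close> from becoming
      \<open>Suc 0\<close> lets \<open>on\<close> match.\<close>
    using ee by (simp add: assms(6) inner_add_left inner_sum_left on del: One_nat_def)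
  ultimately show ?thesis
    using medial_axis_map_antipodal[of "e 1" \<alpha> lam z] assms(3,4) by (simp add: assms(5))
qed

end
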